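(* Let $\mathcal{H}$ be an $r$-uniform hypergraph with $r\geq 3$ and $\Delta(\mathcal{H})=2$. Then $\tau(\mathcal{H})\leq (r-1)\cdot \nu(\mathcal{H})$.
   Context: A hypergraph $\mathcal{H}=(V,E)$ has a finite vertex set $V$ and a multiset $E$ of subsets of $V$; it is $r$-uniform if every hyperedge has exactly $r$ vertices. $\tau(\mathcal{H})=\min\{|T|: T\subseteq V,\ T\cap f\neq\emptyset\ \forall f\in E\}$; $\nu(\mathcal{H})$ is the maximum number of pairwise disjoint hyperedges; $\Delta(\mathcal{H})$ is the maximum number of hyperedges containing a common vertex. *)

theory Defs
  imports "HOL-Library.Multiset"
begin

text \<open>The hyperedges form a multiset: parallel hyperedges are allowed and are counted
  with multiplicity in all the parameters below.\<close>

definition hypergraph :: "'a set \<Rightarrow> 'a set multiset \<Rightarrow> bool" where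
  "hypergraph V E \<longleftrightarrow> finite V \<and> (\<forall>f. f \<in># E \<longrightarrow> f \<subseteq> V)"

definition uniform :: "nat \<Rightarrow> 'a set multiset \<Rightarrow> bool" where
  "uniform r E \<longleftrightarrow> (\<forall>f. f \<in># E \<longrightarrow> card f = r)"

definition vertex_cover :: "'a set \<Rightarrow> 'a set multiset \<Rightarrow> 'a set \<Rightarrow> bool" where
  "vertex_cover V E T \<longleftrightarrow> T \<subseteq> V \<and> (\<forall>f. f \<in># E \<longrightarrow> T \<inter> f \<noteq> {})"

text \<open>The minimum is over a nonempty set as long as no hyperedge is empty.\<close>

definition \<tau> :: "'a set \<Rightarrow> 'a set multiset \<Rightarrow> nat" where
  "\<tau> V E = Min (card ` {T. vertex_cover V E T})"

text \<open>A pair of hyperedges taken from \<open>M\<close> is a two-element submultiset of \<open>M\<close>;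
  in particular, two parallel copies of a nonempty hyperedge are not disjoint.\<close>

definition matching :: "'a set multiset \<Rightarrow> 'a set multiset \<Rightarrow> bool" where
  "matching E M \<longleftrightarrow> M \<subseteq># E \<and> (\<forall>f g. {#f, g#} \<subseteq># M \<longrightarrow> f \<inter> g = {})"

definition \<nu> :: "'a set multiset \<Rightarrow> nat" where
  "\<nu> E = Max (size ` {M. matching E M})"

definition degree :: "'a set multiset \<Rightarrow> 'a \<Rightarrow> nat" where
  "degree E v = size {#f \<in># E. v \<in> f#}"

text \<open>Inserting \<open>0\<close> only matters for the hypergraph without vertices.\<close>

definition \<Delta> :: "'a set \<Rightarrow> 'a set multiset \<Rightarrow> nat" where
  "\<Delta> V E = Max (insert 0 (degree E ` V))"

end

theory Submission
  imports Defs
begin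

text \<open>Pass to the graph whose nodes are the hyperedges, adjacent when they meet. Since \<open>\<Delta> \<le> 2\<close>,
  its degrees are at most \<open>r\<close>; matchings of the hypergraph are independent sets, and a family of
  \<open>p\<close> edges and single nodes covering the graph yields a vertex cover of size \<open>p\<close>.

  All quantities are additive over components, so let the graph be connected with \<open>n\<close> nodes and
  independence number \<open>\<alpha>\<close>. A maximal graph matching leaves an independent set of \<open>u \<le> \<alpha>\<close> nodes,
  so \<open>2 p = n + u\<close>. Deleting a closed neighbourhood, which has at most \<open>r + 1\<close> nodes, leaves a
  graph in which, by connectedness, every induced subgraph has a node of degree less than \<open>r\<close>;
  choosing nodes greedily there gives \<open>n \<le> r \<alpha> + 1\<close>. Thus
  \<open>2 p \<le> (r + 1) \<alpha> + 1 \<le> 2 (r - 1) \<alpha> + 1\<close>, and the last summand disappears by parity.\<close>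

section \<open>Edge covers and independent sets in graphs of bounded degree\<close>

definition independent :: "('b \<Rightarrow> 'b \<Rightarrow> bool) \<Rightarrow> 'b set \<Rightarrow> bool" where
  "independent adj I \<longleftrightarrow> (\<forall>x\<in>I. \<forall>y\<in>I. \<not> adj x y)"

text \<open>Singletons admit isolated nodes. Pieces may overlap, as only upper bounds on
  \<open>card P\<close> matter; the equation \<open>\<Union>P = S\<close> keeps every piece inside
  \<open>S\<close>.\<close>

definition edge_cover :: "('b \<Rightarrow> 'b \<Rightarrow> bool) \<Rightarrow> 'b set \<Rightarrow> 'b set set \<Rightarrow> bool" where
  "edge_cover adj S P \<longleftrightarrow>
     finite P \<and> \<Union>P = S \<and> (\<forall>p\<in>P. (\<exists>x. p = {x}) \<or> (\<exists>x y. adj x y \<and> p = {x, y}))"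

lemma edge_cover_union:
  assumes "edge_cover adj A P" "edge_cover adj B Q"
  shows "edge_cover adj (A \<union> B) (P \<union> Q)"
  using assms unfolding edge_cover_def by auto

text \<open>Adjacent pairs are split off until the remainder \<open>U\<close> is independent. A pair
  spends one piece on two nodes, a node of \<open>U\<close> one piece on itself.\<close>

lemma edge_cover_from_maximal_matching:
  assumes "finite S" "irreflp adj"
  shows "\<exists>P U. edge_cover adj S P \<and> U \<subseteq> S \<and> independent adj U \<and> 2 * card P \<le> card S + card U"
  using assms(1)
proof (induction S rule: finite_psubset_induct)
  case (psubset S)
  show ?case
  proof (cases "independent adj S")
    case True
    have "edge_cover adj S ((\<lambda>x. {x}) ` S)"
      using psubset.hyps unfolding edge_cover_def by auto
    moreover have "card ((\<lambda>x. {x}) ` S) \<le> card S"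
      using psubset.hyps by (rule card_image_le)
    ultimately show ?thesis
      using True by (intro exI[of _ "(\<lambda>x. {x}) ` S"] exI[of _ S]) auto
  next
    case False
    then obtain x y where xy: "x \<in> S" "y \<in> S" "adj x y"
      unfolding independent_def by auto
    then have "x \<noteq> y"
      using assms(2) by (auto dest: irreflpD)
    have "S - {x, y} \<subset> S"
      using xy by auto
    from psubset.IH[OF this] obtain P U where
      PU: "edge_cover adj (S - {x, y}) P" "U \<subseteq> S - {x, y}" "independent adj U"
        "2 * card P \<le> card (S - {x, y}) + card U"
      by auto
    have "edge_cover adj {x, y} {{x, y}}"
      using xy unfolding edge_cover_def by auto
    then have "edge_cover adj ({x, y} \<union> (S - {x, y})) ({{x, y}} \<union> P)"
      using PU(1) by (rule edge_cover_union)
    moreover have "{x, y} \<union> (S - {x, y}) = S"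
      using xy by auto
    ultimately have cover: "edge_cover adj S (insert {x, y} P)"
      by simp
    have "card S = card (S - {x, y}) + 2"
      using xy \<open>x \<noteq> y\<close> psubset.hyps card_mono[of S "{x, y}"] by (simp add: card_Diff_subset)
    moreover have "card (insert {x, y} P) \<le> card P + 1"
      using PU(1) by (simp add: edge_cover_def card_insert_if)
    ultimately show ?thesis
      using cover PU by (intro exI[of _ "insert {x, y} P"] exI[of _ U]) auto
  qed
qed

lemma independent_insert_nonneighbours:
  assumes "symp adj" "irreflp adj" "independent adj I" "I \<subseteq> S - insert x {y \<in> S. adj x y}"
  shows "independent adj (insert x I)"
proof -
  have "\<not> adj x y" if "y \<in> insert x I" for y
    using that assms(4) irreflpD[OF assms(2)] by auto
  then show ?thesis
    using assms(3) sympD[OF assms(1), of _ x] unfolding independent_def by blast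
qed

text \<open>Greedy choice: a node with fewer than \<open>r\<close> neighbours is taken and at most
  \<open>r\<close> nodes, itself included, are discarded. The degree condition ranges over all
  subsets, so it survives the deletion.\<close>

lemma independent_set_of_degenerate:
  assumes "finite S" "symp adj" "irreflp adj"
    and "\<And>T. T \<subseteq> S \<Longrightarrow> T \<noteq> {} \<Longrightarrow> \<exists>x\<in>T. card {y \<in> T. adj x y} < r"
  shows "\<exists>I \<subseteq> S. independent adj I \<and> card S \<le> r * card I"
  using assms(1,4)
proof (induction S rule: finite_psubset_induct)
  case (psubset S)
  show ?case
  proof (cases "S = {}")
    case True
    then show ?thesis by (auto simp: independent_def)
  next
    case False
    then obtain x where x: "x \<in> S" "card {y \<in> S. adj x y} < r"
      using psubset.prems by blast
    define N where "N = insert x {y \<in> S. adj x y}"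
    have "S - N \<subset> S"
      using x by (auto simp: N_def)
    then obtain I where I: "I \<subseteq> S - N" "independent adj I" "card (S - N) \<le> r * card I"
      using psubset.IH[of "S - N"] psubset.prems by (metis psubset_imp_subset subset_trans)
    have "independent adj (insert x I)"
      using assms(2,3) I(2) I(1)[unfolded N_def] by (rule independent_insert_nonneighbours)
    moreover have "card (insert x I) = card I + 1"
      using I(1) psubset.hyps finite_subset[of I S] by (subst card_insert_disjoint) (auto simp: N_def)
    moreover have "card N \<le> r"
      using x psubset.hyps by (simp add: N_def card_insert_if)
    moreover have "card S \<le> card (S - N) + card N"
      using psubset.hyps diff_card_le_card_Diff[of N S] by (simp add: N_def)
    ultimately show ?thesis
      using I x by (intro exI[of _ "insert x I"]) (auto simp: algebra_simps)
  qed
qed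

text \<open>Connectedness is phrased as: an edge leaves every nonempty proper subset. After deleting
  the closed neighbourhood of any node \<open>v\<close>, each remaining \<open>T\<close> is such a
  subset, and the endpoint in \<open>T\<close> of a leaving edge has degree below \<open>r\<close>
  within \<open>T\<close>.\<close>

lemma independent_set_of_connected:
  assumes "finite S" "S \<noteq> {}" "symp adj" "irreflp adj"
    and degree_le: "\<And>x. x \<in> S \<Longrightarrow> card {y \<in> S. adj x y} \<le> r"
    and connected: "\<And>T. T \<subset> S \<Longrightarrow> T \<noteq> {} \<Longrightarrow> \<exists>x\<in>T. \<exists>y\<in>S - T. adj x y"
  shows "\<exists>I \<subseteq> S. independent adj I \<and> I \<noteq> {} \<and> card S \<le> r * card I + 1"
proof -
  obtain v where "v \<in> S"
    using assms(2) by auto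
  define N where "N = insert v {y \<in> S. adj v y}"
  have "\<exists>x\<in>T. card {y \<in> T. adj x y} < r" if T: "T \<subseteq> S - N" "T \<noteq> {}" for T
  proof -
    have "T \<subset> S"
      using T \<open>v \<in> S\<close> by (auto simp: N_def)
    then obtain x y where xy: "x \<in> T" "y \<in> S - T" "adj x y"
      using connected T(2) by metis
    have "{y \<in> T. adj x y} \<subset> {y \<in> S. adj x y}"
      using xy \<open>T \<subset> S\<close> by auto
    then have "card {y \<in> T. adj x y} < card {y \<in> S. adj x y}"
      using assms(1) by (intro psubset_card_mono) auto
    also have "\<dots> \<le> r"
      using degree_le xy \<open>T \<subset> S\<close> by auto
    finally show ?thesis
      using xy by blast
  qed
  then obtain I where I: "I \<subseteq> S - N" "independent adj I" "card (S - N) \<le> r * card I"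
    using independent_set_of_degenerate[of "S - N" adj r] assms(1,3,4) by auto
  have "independent adj (insert v I)"
    using assms(3,4) I(2) I(1)[unfolded N_def] by (rule independent_insert_nonneighbours)
  moreover have "card (insert v I) = card I + 1"
    using I(1) assms(1) finite_subset[of I S] by (subst card_insert_disjoint) (auto simp: N_def)
  \<comment> \<open>All \<open>r\<close> neighbours of \<open>v\<close> may lie in \<open>S\<close>,
    so this first choice can cost one node more than the later ones; hence the summand 1 in the
    bound.\<close>
  moreover have "card N \<le> r + 1"
    using degree_le[OF \<open>v \<in> S\<close>] assms(1) by (simp add: N_def card_insert_if)
  moreover have "card S \<le> card (S - N) + card N"
    using assms(1) diff_card_le_card_Diff[of N S] by (simp add: N_def)
  ultimately show ?thesis
    using I \<open>v \<in> S\<close> by (intro exI[of _ "insert v I"]) (auto simp: algebra_simps)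
qed

lemma edge_cover_of_connected:
  assumes "finite S" "S \<noteq> {}" "symp adj" "irreflp adj" "r \<ge> 3"
    and "\<And>x. x \<in> S \<Longrightarrow> card {y \<in> S. adj x y} \<le> r"
    and "\<And>T. T \<subset> S \<Longrightarrow> T \<noteq> {} \<Longrightarrow> \<exists>x\<in>T. \<exists>y\<in>S - T. adj x y"
  shows "\<exists>I P. I \<subseteq> S \<and> independent adj I \<and> edge_cover adj S P \<and> card P \<le> (r - 1) * card I"
proof -
  obtain J where J: "J \<subseteq> S" "independent adj J" "J \<noteq> {}" "card S \<le> r * card J + 1"
    using independent_set_of_connected[OF assms(1-4,6,7)] by auto
  obtain P U where
    PU: "edge_cover adj S P" "U \<subseteq> S" "independent adj U" "2 * card P \<le> card S + card U"
    using edge_cover_from_maximal_matching[OF assms(1,4)] by auto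
  \<comment> \<open>The larger of \<open>J\<close> and \<open>U\<close> serves both estimates at
    once.\<close>
  obtain I where I: "I \<subseteq> S" "independent adj I" "card J \<le> card I" "card U \<le> card I"
    using J(1,2) PU(2,3) by (cases "card J \<le> card U") auto
  \<comment> \<open>Writing \<open>r\<close> as \<open>k + 3\<close> removes the truncated
    subtraction; \<open>r + 1 \<le> 2 * (r - 1)\<close> amounts to \<open>r \<ge> 3\<close>.\<close>
  obtain k where r: "r = k + 3"
    using assms(5) by (auto simp: le_iff_add add.commute)
  have "2 * card P \<le> r * card I + 1 + card I"
    using PU(4) J(4) I(3,4) mult_le_mono2[OF I(3), of r] by linarith
  also have "\<dots> \<le> 2 * ((r - 1) * card I) + 1"
    by (simp add: r algebra_simps)
  finally have "card P \<le> (r - 1) * card I"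
    by linarith
  then show ?thesis
    using I PU by blast
qed

text \<open>If no edge joins \<open>T\<close> to \<open>S - T\<close>, the induction hypothesis
  applies to both sides, since degrees only drop in subsets, and the results are united. Otherwise
  \<open>S\<close> is empty or connected.\<close>

lemma edge_cover_le_independent:
  assumes "finite S" "symp adj" "irreflp adj" "r \<ge> 3"
    and "\<And>x. x \<in> S \<Longrightarrow> card {y \<in> S. adj x y} \<le> r"
  shows "\<exists>I P. I \<subseteq> S \<and> independent adj I \<and> edge_cover adj S P \<and> card P \<le> (r - 1) * card I"
  using assms(1,5)
proof (induction S rule: finite_psubset_induct)
  case (psubset S)
  have sub: "\<exists>I P. I \<subseteq> T \<and> independent adj I \<and> edge_cover adj T P \<and> card P \<le> (r - 1) * card I"
    if "T \<subset> S" for T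
  proof (rule psubset.IH[OF that])
    fix x assume "x \<in> T"
    have "card {y \<in> T. adj x y} \<le> card {y \<in> S. adj x y}"
      using that psubset.hyps by (intro card_mono) auto
    then show "card {y \<in> T. adj x y} \<le> r"
      using psubset.prems[of x] that \<open>x \<in> T\<close> by auto
  qed
  consider "S = {}"
    | "S \<noteq> {}" "\<And>T. T \<subset> S \<Longrightarrow> T \<noteq> {} \<Longrightarrow> \<exists>x\<in>T. \<exists>y\<in>S - T. adj x y"
    | T where "T \<subset> S" "T \<noteq> {}" "\<And>x y. x \<in> T \<Longrightarrow> y \<in> S - T \<Longrightarrow> \<not> adj x y"
    by metis
  then show ?case
  proof cases
    case 1
    then show ?thesis
      by (intro exI[of _ "{}"]) (auto simp: independent_def edge_cover_def)
  next
    case 2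
    show ?thesis
      by (rule edge_cover_of_connected) (fact psubset.hyps 2 assms(2-4) psubset.prems)+
  next
    case 3
    obtain I P where IP: "I \<subseteq> T" "independent adj I" "edge_cover adj T P" "card P \<le> (r - 1) * card I"
      using sub[OF 3(1)] by auto
    have "S - T \<subset> S"
      using 3 by auto
    from sub[OF this] obtain J Q where
      JQ: "J \<subseteq> S - T" "independent adj J" "edge_cover adj (S - T) Q" "card Q \<le> (r - 1) * card J"
      by auto
    have "independent adj (I \<union> J)"
      using IP(1,2) JQ(1,2) 3(3) sympD[OF assms(2)] unfolding independent_def by blast
    moreover have "edge_cover adj S (P \<union> Q)"
      using edge_cover_union[OF IP(3) JQ(3)] 3(1) by (simp add: Un_absorb1 psubset_imp_subset)
    moreover have "card (I \<union> J) = card I + card J"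
      using IP(1) JQ(1) 3(1) finite_subset[of I S] finite_subset[of J S] psubset.hyps
      by (intro card_Un_disjoint) auto
    moreover have "card (P \<union> Q) \<le> card P + card Q"
      by (rule card_Un_le)
    ultimately show ?thesis
      using IP JQ 3(1) by (intro exI[of _ "I \<union> J"] exI[of _ "P \<union> Q"]) (auto simp: algebra_simps)
  qed
qed

section \<open>From hypergraphs to their intersection graphs\<close>

lemma tau_le_card:
  assumes "hypergraph V E" "vertex_cover V E T"
  shows "\<tau> V E \<le> card T"
proof -
  have "finite {T. vertex_cover V E T}"
    using assms(1) finite_subset[of "{T. vertex_cover V E T}" "Pow V"]
    by (auto simp: hypergraph_def vertex_cover_def)
  then show ?thesis
    using assms(2) unfolding \<tau>_def by (intro Min_le) auto
qed

lemma size_le_nu: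
  assumes "matching E M"
  shows "size M \<le> \<nu> E"
proof -
  have "size ` {M. matching E M} \<subseteq> {..size E}"
    by (auto simp: matching_def size_mset_mono)
  then show ?thesis
    using assms unfolding \<nu>_def by (intro Max_ge) (auto intro: finite_subset)
qed

lemma degree_le_Delta:
  assumes "finite V" "v \<in> V"
  shows "degree E v \<le> \<Delta> V E"
  using assms unfolding \<Delta>_def by (intro Max_ge) auto

text \<open>Indices turn parallel hyperedges into distinct nodes of the graph.\<close>

lemma multiset_as_image:
  "\<exists>(F :: nat \<Rightarrow> 'b) n. E = image_mset F (mset_set {..<n})"
proof -
  obtain es where "E = mset es"
    by (metis ex_mset)
  then have "E = image_mset (nth es) (mset_set {..<length es})"
    by (metis map_nth mset_map mset_upt atLeast0LessThan)
  then show ?thesis by blast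
qed

lemma degree_image_mset:
  assumes "finite A"
  shows "degree (image_mset F (mset_set A)) v = card {i \<in> A. v \<in> F i}"
  using assms by (simp add: degree_def filter_mset_image_mset)

lemma matching_image_mset:
  assumes "finite A" "I \<subseteq> A" "\<And>i j. i \<in> I \<Longrightarrow> j \<in> I \<Longrightarrow> i \<noteq> j \<Longrightarrow> F i \<inter> F j = {}"
  shows "matching (image_mset F (mset_set A)) (image_mset F (mset_set I))"
  unfolding matching_def
proof (intro conjI allI impI)
  have fin: "finite I"
    using assms(1,2) by (rule finite_subset[rotated])
  show "image_mset F (mset_set I) \<subseteq># image_mset F (mset_set A)"
    using assms(1,2) by (intro image_mset_subseteq_mono subset_imp_msubset_mset_set)
  fix f g assume fg: "{#f, g#} \<subseteq># image_mset F (mset_set I)"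
  then have "f \<in># image_mset F (mset_set I)"
    by (meson mset_subset_eqD union_single_eq_member)
  then obtain i where i: "i \<in> I" "f = F i"
    using fin by auto
  \<comment> \<open>Removing the index \<open>i\<close> rather than the set \<open>f\<close> yields
    an index \<open>j\<close> different from \<open>i\<close> for \<open>g\<close>, even when
    \<open>f = g\<close>.\<close>
  have "mset_set I = add_mset i (mset_set (I - {i}))"
    using fin i(1) by (simp add: mset_set.remove)
  then have "{#g#} \<subseteq># image_mset F (mset_set (I - {i}))"
    using fg i(2) by simp
  then obtain j where "j \<in> I - {i}" "g = F j"
    using fin by auto
  then show "f \<inter> g = {}"
    using assms(3)[of i j] i by auto
qed

text \<open>Each \<open>j\<close> counted is sent to a vertex common to \<open>F i\<close> and
  \<open>F j\<close>. Two indices with the same image would put that vertex into three hyperedges,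
  so the map into \<open>F i\<close> is injective.\<close>

lemma card_intersecting_le:
  assumes "finite A" "finite (F i)" "i \<in> A"
    and two: "\<And>v. v \<in> F i \<Longrightarrow> card {j \<in> A. v \<in> F j} \<le> 2"
  shows "card {j \<in> A. i \<noteq> j \<and> F i \<inter> F j \<noteq> {}} \<le> card (F i)"
proof -
  define c where "c j = (SOME v. v \<in> F i \<inter> F j)" for j
  have c: "c j \<in> F i \<inter> F j" if "F i \<inter> F j \<noteq> {}" for j
    using that unfolding c_def by (metis ex_in_conv someI_ex)
  have "inj_on c {j \<in> A. i \<noteq> j \<and> F i \<inter> F j \<noteq> {}}"
  proof (rule inj_onI, rule ccontr)
    fix j k
    assume j: "j \<in> {j \<in> A. i \<noteq> j \<and> F i \<inter> F j \<noteq> {}}"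
      and k: "k \<in> {j \<in> A. i \<noteq> j \<and> F i \<inter> F j \<noteq> {}}"
      and eq: "c j = c k" and "j \<noteq> k"
    have "{i, j, k} \<subseteq> {l \<in> A. c j \<in> F l}"
      using c[of j] c[of k] j k eq assms(3) by auto
    then have "card {i, j, k} \<le> card {l \<in> A. c j \<in> F l}"
      using assms(1) by (intro card_mono) auto
    moreover have "card {i, j, k} = 3"
      using j k \<open>j \<noteq> k\<close> by auto
    moreover have "card {l \<in> A. c j \<in> F l} \<le> 2"
      using c[of j] j by (intro two) auto
    ultimately show False by simp
  qed
  moreover have "c ` {j \<in> A. i \<noteq> j \<and> F i \<inter> F j \<noteq> {}} \<subseteq> F i"
    using c by auto
  ultimately show ?thesis
    using assms(2) by (rule card_inj_on_le)
qed

text \<open>The hyperedges of a piece share a vertex, as a piece is one nonempty hyperedge or two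
  that meet. One such vertex per piece hits everything.\<close>

lemma tau_le_edge_cover:
  assumes "hypergraph V (image_mset F (mset_set A))" "finite A" "\<And>i. i \<in> A \<Longrightarrow> F i \<noteq> {}"
    and cover: "edge_cover (\<lambda>i j. i \<noteq> j \<and> F i \<inter> F j \<noteq> {}) A P"
  shows "\<tau> V (image_mset F (mset_set A)) \<le> card P"
proof -
  have "\<exists>v. v \<in> (\<Inter>i\<in>p. F i)" if "p \<in> P" for p
    using that cover assms(3) unfolding edge_cover_def by fastforce
  then obtain c where c: "c p \<in> (\<Inter>i\<in>p. F i)" if "p \<in> P" for p
    by metis
  have mem: "\<exists>p\<in>P. i \<in> p" if "i \<in> A" for i
    using that cover unfolding edge_cover_def by auto
  have "c p \<in> V" if "p \<in> P" for p
  proof -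
    \<comment> \<open>An empty \<open>p\<close> would make the intersection the whole type; a member
      of \<open>p\<close> places \<open>c p\<close> in a hyperedge and so in
      \<open>V\<close>.\<close>
    have "p \<noteq> {}" "p \<subseteq> A"
      using that cover unfolding edge_cover_def by auto
    then obtain i where "i \<in> p" "i \<in> A"
      by auto
    then show ?thesis
      using c[OF that] assms(1,2) unfolding hypergraph_def by auto
  qed
  moreover have "c ` P \<inter> F i \<noteq> {}" if "i \<in> A" for i
    using mem[OF that] c by fastforce
  ultimately have "vertex_cover V (image_mset F (mset_set A)) (c ` P)"
    using assms(2) unfolding vertex_cover_def by auto
  then have "\<tau> V (image_mset F (mset_set A)) \<le> card (c ` P)"
    using assms(1) by (rule tau_le_card[rotated])
  also have "\<dots> \<le> card P"
    using cover by (intro card_image_le) (simp add: edge_cover_def)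
  finally show ?thesis .
qed

theorem theorem14:
  fixes V :: "'a set" and E :: "'a set multiset" and r :: nat
  assumes "hypergraph V E"
    and "uniform r E"
    and "r \<ge> 3"
    and "\<Delta> V E = 2"
  shows "\<tau> V E \<le> (r - 1) * \<nu> E"
proof -
  obtain F and n :: nat where E: "E = image_mset F (mset_set {..<n})"
    using multiset_as_image[of E] by (elim exE) (rule that)
  define adj where "adj i j \<longleftrightarrow> i \<noteq> j \<and> F i \<inter> F j \<noteq> {}" for i j
  have F: "F i \<subseteq> V" "card (F i) = r" if "i < n" for i
    using that assms(1,2) by (auto simp: E hypergraph_def uniform_def)
  have "card {j \<in> {..<n}. adj i j} \<le> r" if "i \<in> {..<n}" for i
  proof -
    \<comment> \<open>The number of indices whose hyperedge contains \<open>v\<close> is its degree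
      with multiplicity, which \<open>\<Delta> V E\<close> bounds.\<close>
    have "card {j \<in> {..<n}. v \<in> F j} \<le> 2" if "v \<in> F i" for v
      using degree_le_Delta[of V v E] that F(1)[of i] \<open>i \<in> {..<n}\<close> assms(1,4)
      unfolding E by (auto simp: degree_image_mset hypergraph_def)
    moreover have "finite (F i)"
      using F[of i] that assms(3) by (intro card_ge_0_finite) auto
    ultimately show ?thesis
      using card_intersecting_le[of "{..<n}" F i] F(2)[of i] that by (simp add: adj_def)
  qed
  moreover have "symp adj" "irreflp adj"
    by (auto simp: adj_def intro!: sympI irreflpI)
  ultimately obtain I P where
    IP: "I \<subseteq> {..<n}" "independent adj I" "edge_cover adj {..<n} P" "card P \<le> (r - 1) * card I"
    using edge_cover_le_independent[of "{..<n}" adj r] assms(3) by auto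
  have "\<tau> V E \<le> card P"
    unfolding E
  proof (rule tau_le_edge_cover)
    show "hypergraph V (image_mset F (mset_set {..<n}))"
      using assms(1) E by simp
    show "F i \<noteq> {}" if "i \<in> {..<n}" for i
      using F(2)[of i] that assms(3) by auto
    show "edge_cover (\<lambda>i j. i \<noteq> j \<and> F i \<inter> F j \<noteq> {}) {..<n} P"
      using IP(3) unfolding adj_def .
  qed simp
  also note IP(4)
  \<comment> \<open>Nonadjacent distinct indices carry disjoint hyperedges, so \<open>I\<close>
    gives a matching with one member per index.\<close>
  also have "card I = size (image_mset F (mset_set I))"
    by simp
  also have "\<dots> \<le> \<nu> E"
    unfolding E using IP(1,2)
    by (intro size_le_nu matching_image_mset) (auto simp: independent_def adj_def)
  finally show ?thesis
    by simp
qed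

end
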